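(* For $t\in\mathbb{C}$, the filiform Lie algebra $\mathfrak{f}_t$ is isomorphic to $\mathfrak{f}$ (as a complex Lie algebra) if and only if $t=0$.
   Context: $\mathfrak{f}=\mathfrak{f}_{13}$ is the 13-dimensional filiform complex Lie algebra with basis $e_0,e_1,\dots,e_{12}$ and the following brackets (extended by antisymmetry; all brackets $[e_i,e_j]$ with $i<j$ not listed are zero): $[e_0,e_i]=e_{i+1}$ for $1\le i\le 11$; $[e_1,e_2]=e_4$, $[e_1,e_3]=e_5$, $[e_1,e_4]=\frac{9}{10}e_6-e_8$, $[e_1,e_5]=\frac{4}{5}e_7-2e_9$, $[e_1,e_6]=\frac{5}{7}e_8-\frac{335}{126}e_{10}+\frac{22105}{15246}e_{12}$, $[e_1,e_7]=\frac{9}{14}e_9-\frac{125}{42}e_{11}$, $[e_1,e_8]=\frac{7}{12}e_{10}-\frac{4421}{1452}e_{12}$, $[e_1,e_9]=\frac{8}{15}e_{11}$, $[e_1,e_{10}]=\frac{27}{55}e_{12}$; $[e_2,e_3]=\frac{1}{10}e_6+e_8$, $[e_2,e_4]=\frac{1}{10}e_7+e_9$, $[e_2,e_5]=\frac{3}{35}e_8+\frac{83}{126}e_{10}-\frac{22105}{15246}e_{12}$, $[e_2,e_6]=\frac{1}{14}e_9+\frac{20}{63}e_{11}$, $[e_2,e_7]=\frac{5}{84}e_{10}+\frac{697}{10164}e_{12}$, $[e_2,e_8]=\frac{1}{20}e_{11}$, $[e_2,e_9]=\frac{7}{165}e_{12}$; $[e_3,e_4]=\frac{1}{70}e_8+\frac{43}{126}e_{10}+\frac{22105}{15246}e_{12}$,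 $[e_3,e_5]=\frac{1}{70}e_9+\frac{43}{126}e_{11}$, $[e_3,e_6]=\frac{1}{84}e_{10}+\frac{7589}{30492}e_{12}$, $[e_3,e_7]=\frac{1}{105}e_{11}$, $[e_3,e_8]=\frac{1}{132}e_{12}$; $[e_4,e_5]=\frac{1}{420}e_{10}+\frac{313}{3388}e_{12}$, $[e_4,e_6]=\frac{1}{420}e_{11}$, $[e_4,e_7]=\frac{3}{1540}e_{12}$; $[e_5,e_6]=\frac{1}{2310}e_{12}$. Let $\mathfrak{h}=[\mathfrak{f},\mathfrak{f}]=\langle e_2,\dots,e_{12}\rangle$ and let $D$ be the derivation of $\mathfrak{h}$ given by $D(e_2)=e_9$, $D(e_3)=e_{10}$, $D(e_4)=e_{11}$, $D(e_5)=e_{12}$ and $D(e_i)=0$ for $6\le i\le 12$. For $t\in\mathbb{C}$, the deformed Lie algebra $\mathfrak{f}_t$ is the vector space underlying $\mathfrak{f}$ with the Lie bracket $[\ ,\ ]_t$ determined by $[e_0,e_1]_t=[e_0,e_1]$, $[e_0,h]_t=[e_0,h]$, $[e_1,h]_t=[e_1,h]+tD(h)$ and $[h,h']_t=[h,h']$ for all $h,h'\in\mathfrak{h}$. *)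

theory Defs
  imports "HOL-Analysis.Analysis"
begin

locale lie_algebra =
  fixes br :: "'a::field ^ 'n \<Rightarrow> 'a ^ 'n \<Rightarrow> 'a ^ 'n"
  assumes linear_left: "Vector_Spaces.linear (*s) (*s) (\<lambda>x. br x y)"
    and linear_right: "Vector_Spaces.linear (*s) (*s) (br x)"
    and alternating: "br x x = 0"
    and jacobi: "br x (br y z) + br y (br z x) + br z (br x y) = 0"

definition lie_isomorphic ::
  "('a::field ^ 'n \<Rightarrow> 'a ^ 'n \<Rightarrow> 'a ^ 'n) \<Rightarrow> ('a ^ 'm \<Rightarrow> 'a ^ 'm \<Rightarrow> 'a ^ 'm) \<Rightarrow> bool" where
  "lie_isomorphic br br' \<longleftrightarrow>
    (\<exists>\<phi>. Vector_Spaces.linear (*s) (*s) \<phi> \<and> bij \<phi> \<and> (\<forall>x y. \<phi> (br x y) = br' (\<phi> x) (\<phi> y)))"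

definition derived_algebra :: "('a::field ^ 'n \<Rightarrow> 'a ^ 'n \<Rightarrow> 'a ^ 'n) \<Rightarrow> ('a ^ 'n) set" where
  "derived_algebra br = vec.span {br x y | x y. True}"

primrec lower_central :: "('a::field ^ 'n \<Rightarrow> 'a ^ 'n \<Rightarrow> 'a ^ 'n) \<Rightarrow> nat \<Rightarrow> ('a ^ 'n) set" where
  "lower_central br 0 = UNIV"
| "lower_central br (Suc k) = vec.span {br x y | x y. y \<in> lower_central br k}"

text \<open>Filiform: nilpotent of the maximal class \<open>n - 1\<close>, where \<open>n\<close> is the dimension.\<close>

definition filiform :: "('a::field ^ 'n \<Rightarrow> 'a ^ 'n \<Rightarrow> 'a ^ 'n) \<Rightarrow> bool" where
  "filiform br \<longleftrightarrow> lie_algebra br \<and>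
     lower_central br (CARD('n) - 1) = {0} \<and> lower_central br (CARD('n) - 2) \<noteq> {0}"

text \<open>The index type \<open>13\<close> consists of the residues modulo 13, so \<open>ev i\<close> is meant for \<open>i \<le> 12\<close> only;
  \<open>crd x i\<close> is the coefficient of \<open>ev i\<close> in \<open>x\<close>.\<close>

definition ev :: "nat \<Rightarrow> complex ^ 13" where
  "ev i = axis (of_nat i) 1"

definition crd :: "complex ^ 13 \<Rightarrow> nat \<Rightarrow> complex" where
  "crd x i = x $ of_nat i"

text \<open>The nonzero brackets of basis vectors \<open>ev i\<close>, \<open>ev j\<close> with \<open>i < j\<close>.\<close>

definition f13_table :: "((nat \<times> nat) \<times> (complex ^ 13)) list" where
  "f13_table =
    [((0, i), ev (i + 1)). i \<leftarrow> [1..<12]] @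
    [((1, 2), ev 4),
     ((1, 3), ev 5),
     ((1, 4), (9/10) *s ev 6 - ev 8),
     ((1, 5), (4/5) *s ev 7 - 2 *s ev 9),
     ((1, 6), (5/7) *s ev 8 - (335/126) *s ev 10 + (22105/15246) *s ev 12),
     ((1, 7), (9/14) *s ev 9 - (125/42) *s ev 11),
     ((1, 8), (7/12) *s ev 10 - (4421/1452) *s ev 12),
     ((1, 9), (8/15) *s ev 11),
     ((1, 10), (27/55) *s ev 12),
     ((2, 3), (1/10) *s ev 6 + ev 8),
     ((2, 4), (1/10) *s ev 7 + ev 9),
     ((2, 5), (3/35) *s ev 8 + (83/126) *s ev 10 - (22105/15246) *s ev 12),
     ((2, 6), (1/14) *s ev 9 + (20/63) *s ev 11),
     ((2, 7), (5/84) *s ev 10 + (697/10164) *s ev 12),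
     ((2, 8), (1/20) *s ev 11),
     ((2, 9), (7/165) *s ev 12),
     ((3, 4), (1/70) *s ev 8 + (43/126) *s ev 10 + (22105/15246) *s ev 12),
     ((3, 5), (1/70) *s ev 9 + (43/126) *s ev 11),
     ((3, 6), (1/84) *s ev 10 + (7589/30492) *s ev 12),
     ((3, 7), (1/105) *s ev 11),
     ((3, 8), (1/132) *s ev 12),
     ((4, 5), (1/420) *s ev 10 + (313/3388) *s ev 12),
     ((4, 6), (1/420) *s ev 11),
     ((4, 7), (3/1540) *s ev 12),
     ((5, 6), (1/2310) *s ev 12)]"

definition f13_basis :: "nat \<Rightarrow> nat \<Rightarrow> complex ^ 13" where
  "f13_basis i j =
    (case map_of f13_table (i, j) of Some v \<Rightarrow> v
     | None \<Rightarrow> (case map_of f13_table (j, i) of Some v \<Rightarrow> - v | None \<Rightarrow> 0))"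

definition f13 :: "complex ^ 13 \<Rightarrow> complex ^ 13 \<Rightarrow> complex ^ 13" where
  "f13 x y = (\<Sum>i<13. \<Sum>j<13. (crd x i * crd y j) *s f13_basis i j)"

text \<open>The derivation \<open>der_D\<close> of \<open>[f, f] = \<langle>ev 2, \<dots>, ev 12\<rangle>\<close>, extended to the whole space by
  \<open>der_D (ev 0) = der_D (ev 1) = 0\<close>.\<close>

definition der_D :: "complex ^ 13 \<Rightarrow> complex ^ 13" where
  "der_D x = crd x 2 *s ev 9 + crd x 3 *s ev 10 + crd x 4 *s ev 11 + crd x 5 *s ev 12"

text \<open>Because the extended \<open>der_D\<close> kills \<open>ev 0\<close> and \<open>ev 1\<close>, the bilinear alternating form below is the
  one prescribed by its values on \<open>(ev 0, ev 1)\<close>, \<open>(ev 0, h)\<close>, \<open>(ev 1, h)\<close> and \<open>(h, h')\<close>;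
  see \<open>f13_deformed_unique\<close>.\<close>

definition f13_deformed :: "complex \<Rightarrow> complex ^ 13 \<Rightarrow> complex ^ 13 \<Rightarrow> complex ^ 13" where
  "f13_deformed t x y = f13 x y + t *s (crd x 1 *s der_D y - crd y 1 *s der_D x)"

lemma of_nat_13_eq_iff: "i < 13 \<Longrightarrow> j < 13 \<Longrightarrow> (of_nat i :: 13) = of_nat j \<longleftrightarrow> i = j"
  by (simp add: bit1.of_nat_eq bit1.Rep_inject_sym bit1.Abs_inverse)

lemma UNIV_13: "(UNIV :: 13 set) = of_nat ` {..<13}"
proof -
  have "card (of_nat ` {..<13} :: 13 set) = CARD(13)"
    by (subst card_image) (auto simp: inj_on_def of_nat_13_eq_iff)
  then show ?thesis
    by (metis card_subset_eq finite subset_UNIV)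
qed

lemma all_less_13:
  "(\<forall>i<13. P i) \<longleftrightarrow> P 0 \<and> P 1 \<and> P 2 \<and> P 3 \<and> P 4 \<and> P 5 \<and> P 6 \<and> P 7 \<and> P 8 \<and> P 9 \<and> P 10 \<and>
     P 11 \<and> P (12::nat)"
proof -
  have "(\<forall>i<13. P i) \<longleftrightarrow> (\<forall>i\<in>set [0..<13]. P i)"
    by auto
  also have "[0..<13] = [0, 1, 2, 3, 4, 5, 6, 7, 8, 9, 10, 11, 12::nat]"
    by (simp add: upt_conv_Cons)
  finally show ?thesis
    by (simp only: list.set ball_simps) simp
qed

lemma crd_simps [simp]:
  "crd (x + y) i = crd x i + crd y i" "crd (x - y) i = crd x i - crd y i"
  "crd (- x) i = - crd x i" "crd (c *s x) i = c * crd x i" "crd 0 i = 0"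
  by (simp_all add: crd_def)

lemma crd_sum: "crd (sum f A) i = (\<Sum>a\<in>A. crd (f a) i)"
  by (simp add: crd_def)

lemma crd_ev: "i < 13 \<Longrightarrow> j < 13 \<Longrightarrow> crd (ev i) j = (if i = j then 1 else 0)"
  by (simp add: crd_def ev_def axis_def of_nat_13_eq_iff)

lemma vec13_eq_iff: "x = y \<longleftrightarrow> (\<forall>i<13. crd x i = crd y i)"
proof -
  have "x = y \<longleftrightarrow> (\<forall>i\<in>(UNIV :: 13 set). x $ i = y $ i)"
    by (simp add: vec_eq_iff)
  then show ?thesis
    unfolding UNIV_13 by (auto simp: crd_def)
qed

lemma ev_expansion: "x = (\<Sum>i<13. crd x i *s ev i)"
  by (simp add: vec13_eq_iff crd_sum crd_ev if_distrib cong: if_cong)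

lemma linear_vec_iff:
  "Vector_Spaces.linear (*s) (*s) (g :: complex ^ 13 \<Rightarrow> complex ^ 13) \<longleftrightarrow>
     (\<forall>x y. g (x + y) = g x + g y) \<and> (\<forall>c x. g (c *s x) = c *s g x)"
  by (simp add: Vector_Spaces.linear_iff vec.vector_space_axioms)

lemma linear_zero_13:
  assumes add: "\<And>x y. g (x + y) = g x + g y" and scale: "\<And>c x. g (c *s x) = c *s g x"
    and ev: "\<And>i. i < 13 \<Longrightarrow> g (ev i) = 0"
  shows "g (x :: complex ^ 13) = (0 :: complex ^ 13)"
proof -
  interpret g: Vector_Spaces.linear "(*s)" "(*s)" g
    using add scale by (simp add: linear_vec_iff)
  show ?thesis
    by (subst ev_expansion[of x]) (simp add: g.sum g.scale ev)
qed

lemma upt_1_12: "[1..<12] = [1, 2, 3, 4, 5, 6, 7, 8, 9, 10, 11::nat]"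
  by (simp add: upt_conv_Cons)

lemmas f13_table_list = f13_table_def [unfolded upt_1_12 list.map append.simps]

lemma map_of_Cons_Pair: "map_of (((i, j), v) # xs) (k, l) = (if i = k \<and> j = l then Some v else map_of xs (k, l))"
  by simp

lemmas f13_basis_lookup =
  f13_basis_def [unfolded f13_table_list map_of_Cons_Pair map_of.simps(1)]

text \<open>The premise \<open>g = f13_basis\<close> keeps the left-hand sides folded while the right-hand sides are
  evaluated from the table; likewise in \<open>f13_deformed_ev_aux\<close>.\<close>

lemma f13_basis_values_aux:
  "g = f13_basis \<Longrightarrow> \<forall>i<13. \<forall>j<13. g i j = f13_basis i j"
  by simp

lemmas f13_basis_values =
  f13_basis_values_aux [unfolded all_less_13, simplified (no_asm) f13_basis_lookup,
    simplified (no_asm), unfolded numeral_2_eq_2 [symmetric], OF refl]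

lemma f13_linear_left: "f13 (x + y) z = f13 x z + f13 y z" "f13 (c *s x) z = c *s f13 x z"
  by (simp_all add: f13_def sum.distrib [symmetric] vec.scale_sum_right distrib_right mult.assoc vector_sadd_rdistrib vector_smult_assoc)

lemma f13_linear_right: "f13 z (x + y) = f13 z x + f13 z y" "f13 z (c *s x) = c *s f13 z x"
  by (simp_all add: f13_def sum.distrib [symmetric] vec.scale_sum_right distrib_left mult.left_commute vector_sadd_rdistrib vector_smult_assoc)

lemma f13_ev:
  assumes "i < 13" "j < 13"
  shows "f13 (ev i) (ev j) = f13_basis i j"
proof -
  have "f13 (ev i) (ev j) = (\<Sum>k<13. if i = k then \<Sum>l<13. if j = l then f13_basis k l else 0 else 0)"
    unfolding f13_def
  proof (intro sum.cong refl)
    fix k assume "k \<in> {..<13::nat}"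
    then have "(crd (ev i) k * crd (ev j) l) *s f13_basis k l =
        (if i = k then if j = l then f13_basis k l else 0 else 0)" if "l \<in> {..<13}" for l
      using assms that by (simp add: crd_ev)
    then show "(\<Sum>l<13. (crd (ev i) k * crd (ev j) l) *s f13_basis k l) =
        (if i = k then \<Sum>l<13. if j = l then f13_basis k l else 0 else 0)"
      by simp
  qed
  then show ?thesis using assms by simp
qed

lemma f13_basis_antisym: "i < 13 \<Longrightarrow> j < 13 \<Longrightarrow> f13_basis i j = - f13_basis j i"
proof -
  have "\<forall>i<13. \<forall>j<13. f13_basis i j = - f13_basis j i"
    unfolding all_less_13 by (simp add: f13_basis_values)
  then show "i < 13 \<Longrightarrow> j < 13 \<Longrightarrow> f13_basis i j = - f13_basis j i"
    by blast
qed

lemma f13_antisym: "f13 x y = - f13 y x"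
proof -
  have "f13 x y = (\<Sum>i<13. \<Sum>j<13. (crd x i * crd y j) *s (- f13_basis j i))"
    unfolding f13_def by (intro sum.cong refl) (metis f13_basis_antisym lessThan_iff)
  also have "\<dots> = - f13 y x"
    unfolding f13_def by (subst sum.swap) (simp add: sum_negf mult.commute)
  finally show ?thesis .
qed

lemma der_D_linear: "der_D (x + y) = der_D x + der_D y" "der_D (c *s x) = c *s der_D x"
  by (simp_all add: der_D_def vec_eq_iff algebra_simps)

lemma der_D_ev:
  "der_D (ev 0) = 0" "der_D (ev (Suc 0)) = 0" "der_D (ev 2) = ev 9" "der_D (ev 3) = ev 10"
  "der_D (ev 4) = ev 11" "der_D (ev 5) = ev 12" "der_D (ev 6) = 0" "der_D (ev 7) = 0"
  "der_D (ev 8) = 0" "der_D (ev 9) = 0" "der_D (ev 10) = 0" "der_D (ev 11) = 0" "der_D (ev 12) = 0"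
  by (simp_all add: der_D_def crd_ev)

lemma f13_deformed_linear_left:
  "f13_deformed t (x + y) z = f13_deformed t x z + f13_deformed t y z"
  "f13_deformed t (c *s x) z = c *s f13_deformed t x z"
  by (simp_all add: f13_deformed_def f13_linear_left der_D_linear vec_eq_iff algebra_simps)

lemma f13_deformed_linear_right:
  "f13_deformed t z (x + y) = f13_deformed t z x + f13_deformed t z y"
  "f13_deformed t z (c *s x) = c *s f13_deformed t z x"
  by (simp_all add: f13_deformed_def f13_linear_right der_D_linear vec_eq_iff algebra_simps)

lemma f13_deformed_antisym: "f13_deformed t x y = - f13_deformed t y x"
  using f13_antisym [of x y] by (simp add: f13_deformed_def vec_eq_iff algebra_simps)

lemma f13_deformed_alternating: "f13_deformed t x x = 0"
  using f13_deformed_antisym [of t x x] by (simp add: vec_eq_iff)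

lemma f13_deformed_minus:
  "f13_deformed t (- x) z = - f13_deformed t x z"
  "f13_deformed t z (- x) = - f13_deformed t z x"
  using f13_deformed_linear_left(2) [of t "-1" x z] f13_deformed_linear_right(2) [of t z "-1" x]
  by (simp_all add: vector_sneg_minus1 [symmetric])

lemma f13_deformed_diff:
  "f13_deformed t (x - y) z = f13_deformed t x z - f13_deformed t y z"
  "f13_deformed t z (x - y) = f13_deformed t z x - f13_deformed t z y"
  using f13_deformed_linear_left(1) [of t x "- y" z] f13_deformed_linear_right(1) [of t z x "- y"]
  by (simp_all add: f13_deformed_minus)

lemma f13_deformed_zero: "f13_deformed t 0 z = 0" "f13_deformed t z 0 = 0"
  using f13_deformed_diff [of t z z z] f13_deformed_diff [of t 0 0 z] by simp_all

lemmas f13_deformed_bilinear =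
  f13_deformed_linear_left f13_deformed_linear_right f13_deformed_minus f13_deformed_diff
  f13_deformed_zero

lemma f13_deformed_ev_aux:
  "g = f13_deformed t \<Longrightarrow> \<forall>i<13. \<forall>j<13. g (ev i) (ev j) =
     f13_basis i j + t *s ((if i = 1 then 1 else 0) *s der_D (ev j) - (if j = 1 then 1 else 0) *s der_D (ev i))"
  by (simp add: f13_deformed_def f13_ev crd_ev)

lemmas f13_deformed_ev =
  f13_deformed_ev_aux [unfolded all_less_13, simplified (no_asm), simplified (no_asm) der_D_ev f13_basis_values,
    simplified (no_asm), OF refl]

lemma f13_deformed_jacobi_ordered:
  assumes "i < 13" "j < 13" "k < 13" "i < j" "j < k"
  shows "f13_deformed t (ev i) (f13_deformed t (ev j) (ev k)) +
     f13_deformed t (ev j) (f13_deformed t (ev k) (ev i)) +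
     f13_deformed t (ev k) (f13_deformed t (ev i) (ev j)) = 0"
proof -
  have "\<forall>i<13. \<forall>j<13. i < j \<longrightarrow> (\<forall>k<13. j < k \<longrightarrow>
    f13_deformed t (ev i) (f13_deformed t (ev j) (ev k)) +
     f13_deformed t (ev j) (f13_deformed t (ev k) (ev i)) +
     f13_deformed t (ev k) (f13_deformed t (ev i) (ev j)) = 0)"
    unfolding all_less_13
    by (simp add: f13_deformed_ev f13_deformed_bilinear, intro conjI)
      (simp_all add: vec_eq_iff algebra_simps)
  with assms show ?thesis by blast
qed

lemma f13_deformed_jacobi:
  "f13_deformed t x (f13_deformed t y z) + f13_deformed t y (f13_deformed t z x) +
     f13_deformed t z (f13_deformed t x y) = 0"
proof -
  let ?B = "f13_deformed t"
  define J where "J x y z = ?B x (?B y z) + ?B y (?B z x) + ?B z (?B x y)" for x y z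
  have rot: "J x y z = J y z x" for x y z
    by (simp add: J_def algebra_simps)
  have swap: "J y x z = - J x y z" for x y z
    using f13_deformed_antisym [of t x z] f13_deformed_antisym [of t z y]
      f13_deformed_antisym [of t y x]
    by (simp add: J_def f13_deformed_bilinear)
  have diag: "J x x z = 0" for x z
    using f13_deformed_antisym [of t x z]
    by (simp add: J_def f13_deformed_bilinear f13_deformed_alternating)
  have ordered: "J (ev i) (ev j) (ev k) = 0" if "i < 13" "j < 13" "k < 13" "i < j" "j < k" for i j k
    unfolding J_def using that by (rule f13_deformed_jacobi_ordered)
  have ev: "J (ev i) (ev j) (ev k) = 0" if "i < 13" "j < 13" "k < 13" for i j k
  proof -
    consider "i = j" | "j = k" | "i = k" | "i < j" "j < k" | "j < k" "k < i" | "k < i" "i < j"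
      | "j < i" "i < k" | "i < k" "k < j" | "k < j" "j < i"
      by linarith
    then show ?thesis
      using that ordered diag rot swap by cases (metis neg_equal_0_iff_equal)+
  qed
  have add: "J (x + x') y z = J x y z + J x' y z" and scale: "J (c *s x) y z = c *s J x y z"
    for x x' y z c
    by (simp_all add: J_def f13_deformed_bilinear vector_add_ldistrib algebra_simps)
  have ext: "J x y z = 0" if "\<And>i. i < 13 \<Longrightarrow> J (ev i) y z = 0" for x y z
    by (rule linear_zero_13 [where g = "\<lambda>x. J x y z", OF add scale that])
  have ev1: "J (ev j) (ev k) x = 0" if "j < 13" "k < 13" for x j k
  proof -
    have "J x (ev j) (ev k) = 0"
      by (rule ext) (rule ev [OF _ that])
    then show ?thesis using rot [of x "ev j" "ev k"] by simp
  qed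
  have ev2: "J (ev k) x y = 0" if "k < 13" for x y k
  proof -
    have "J y (ev k) x = 0"
      by (rule ext) (rule ev1 [OF _ that])
    then show ?thesis using rot [of y "ev k" x] by simp
  qed
  have "J x y z = 0"
    by (rule ext) (rule ev2)
  then show ?thesis
    by (simp add: J_def)
qed

theorem lie_algebra_f13_deformed: "lie_algebra (f13_deformed t)"
  by unfold_locales
    (simp_all add: linear_vec_iff f13_deformed_bilinear f13_deformed_alternating f13_deformed_jacobi)

lemma f13_deformed_0: "f13_deformed 0 = f13"
  by (intro ext) (simp add: f13_deformed_def)

theorem lie_algebra_f13: "lie_algebra f13"
  using lie_algebra_f13_deformed [of 0] by (simp add: f13_deformed_0)

lemma bilinear_13_expansion:
  fixes B :: "complex ^ 13 \<Rightarrow> complex ^ 13 \<Rightarrow> complex ^ 13"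
  assumes left: "\<And>y. Vector_Spaces.linear (*s) (*s) (\<lambda>x. B x y)"
    and right: "\<And>x. Vector_Spaces.linear (*s) (*s) (B x)"
  shows "B x y = (\<Sum>i<13. \<Sum>j<13. (crd x i * crd y j) *s B (ev i) (ev j))"
proof -
  have l: "B (sum f A) y = (\<Sum>a\<in>A. B (f a) y)" "B (c *s u) y = c *s B u y" for f :: "nat \<Rightarrow> _" and A c u y
    using left [of y, unfolded Vector_Spaces.linear_iff_module_hom, THEN module_hom.sum]
      left [of y, unfolded Vector_Spaces.linear_iff_module_hom, THEN module_hom.scale] by blast+
  have r: "B y (sum f A) = (\<Sum>a\<in>A. B y (f a))" "B y (c *s u) = c *s B y u" for f :: "nat \<Rightarrow> _" and A c u y
    using right [of y, unfolded Vector_Spaces.linear_iff_module_hom, THEN module_hom.sum]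
      right [of y, unfolded Vector_Spaces.linear_iff_module_hom, THEN module_hom.scale] by blast+
  have "B x y = B (\<Sum>i<13. crd x i *s ev i) (\<Sum>j<13. crd y j *s ev j)"
    by (simp flip: ev_expansion)
  also have "\<dots> = (\<Sum>i<13. \<Sum>j<13. (crd x i * crd y j) *s B (ev i) (ev j))"
    by (simp only: l, simp only: r vec.scale_sum_right vector_smult_assoc)
  finally show ?thesis .
qed

theorem derived_algebra_f13:
  "derived_algebra f13 = vec.span (ev ` {2..12})"
  "derived_algebra f13 = {x. crd x 0 = 0 \<and> crd x 1 = 0}"
proof -
  let ?S = "{x. crd x 0 = 0 \<and> crd x 1 = 0}"
  have "\<forall>i<13. \<forall>j<13. crd (f13_basis i j) 0 = 0 \<and> crd (f13_basis i j) (Suc 0) = 0"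
    unfolding all_less_13 by (simp add: f13_basis_values crd_ev)
  then have "f13 x y \<in> ?S" for x y
    by (simp add: f13_def crd_sum)
  moreover have "vec.subspace ?S"
    by (simp add: vec.subspace_def)
  ultimately have 1: "derived_algebra f13 \<subseteq> ?S"
    unfolding derived_algebra_def by (intro vec.span_minimal) auto
  have "ev i \<in> derived_algebra f13" if "i \<in> {2..12}" for i
  proof -
    have "\<forall>i<13. 2 \<le> i \<longrightarrow> f13 (ev 0) (ev (i - 1)) = ev i"
      unfolding all_less_13 by (simp add: f13_ev f13_basis_values)
    with that have "ev i = f13 (ev 0) (ev (i - 1))"
      by auto
    then show ?thesis
      unfolding derived_algebra_def by (intro vec.span_base) auto
  qed
  then have 2: "vec.span (ev ` {2..12}) \<subseteq> derived_algebra f13"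
    unfolding derived_algebra_def by (intro vec.span_minimal vec.subspace_span) auto
  have 3: "?S \<subseteq> vec.span (ev ` {2..12})"
  proof
    fix x assume x: "x \<in> ?S"
    have "crd x i *s ev i \<in> vec.span (ev ` {2..12})" if "i < 13" for i
    proof (cases "i \<in> {2..12}")
      case True
      then show ?thesis by (intro vec.span_scale vec.span_base) auto
    next
      case False
      then have "i = 0 \<or> i = 1" using that by auto
      then show ?thesis using x by (auto simp: vec.span_zero)
    qed
    then show "x \<in> vec.span (ev ` {2..12})"
      by (subst ev_expansion [of x]) (auto intro: vec.span_sum)
  qed
  from 1 2 3 show "derived_algebra f13 = vec.span (ev ` {2..12})" "derived_algebra f13 = ?S"
    by blast+
qed

theorem der_D_derivation:
  assumes "x \<in> derived_algebra f13" "y \<in> derived_algebra f13"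
  shows "der_D (f13 x y) = f13 (der_D x) y + f13 x (der_D y)"
proof -
  define G where "G x y = der_D (f13_deformed 0 x y) -
    (f13_deformed 0 (der_D x) y + f13_deformed 0 x (der_D y))" for x y
  have lin: "Vector_Spaces.linear (*s) (*s) (\<lambda>x. G x y)" "Vector_Spaces.linear (*s) (*s) (G x)" for x y
    by (simp_all add: linear_vec_iff G_def f13_deformed_bilinear der_D_linear vec_eq_iff algebra_simps)
  have "\<forall>i<13. \<forall>j<13. 2 \<le> i \<longrightarrow> 2 \<le> j \<longrightarrow> G (ev i) (ev j) = 0"
    unfolding all_less_13
    by (simp add: G_def f13_deformed_ev f13_deformed_bilinear der_D_ev)
      (simp add: der_D_def crd_ev)
  then have ev: "G (ev i) (ev j) = 0" if "i < 13" "j < 13" "2 \<le> i" "2 \<le> j" for i j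
    using that by blast
  have small: "i = 0 \<or> i = 1 \<or> 2 \<le> i" for i :: nat
    by auto
  have "(crd x i * crd y j) *s G (ev i) (ev j) = 0" if "i < 13" "j < 13" for i j
    using small [of i] small [of j] ev [OF that] assms by (auto simp: derived_algebra_f13(2))
  then have "G x y = 0"
    unfolding bilinear_13_expansion [OF lin, of x y] by (intro sum.neutral ballI) simp
  then show ?thesis
    by (simp add: G_def f13_deformed_0)
qed

theorem f13_deformed_unique:
  assumes left: "\<And>y. Vector_Spaces.linear (*s) (*s) (\<lambda>x. B x y)"
    and right: "\<And>x. Vector_Spaces.linear (*s) (*s) (B x)"
    and alternating: "\<And>x. B x x = 0"
  shows "B = f13_deformed t \<longleftrightarrow>
    B (ev 0) (ev 1) = f13 (ev 0) (ev 1) \<and>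
    (\<forall>h \<in> derived_algebra f13. B (ev 0) h = f13 (ev 0) h) \<and>
    (\<forall>h \<in> derived_algebra f13. B (ev 1) h = f13 (ev 1) h + t *s der_D h) \<and>
    (\<forall>h \<in> derived_algebra f13. \<forall>h' \<in> derived_algebra f13. B h h' = f13 h h')"
    (is "_ \<longleftrightarrow> ?clauses B")
proof
  show "?clauses B" if "B = f13_deformed t"
    using that by (simp add: f13_deformed_def derived_algebra_f13(2) crd_ev der_D_ev)
next
  assume B: "?clauses B"
  let ?F = "f13_deformed t"
  have F: "?clauses ?F"
    by (simp add: f13_deformed_def derived_algebra_f13(2) crd_ev der_D_ev)
  have antisym: "B x y = - B y x" for x y
    using alternating [of "x + y"] alternating [of x] alternating [of y] left right
    by (simp add: linear_vec_iff eq_neg_iff_add_eq_0 add.commute)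
  have h: "ev i \<in> derived_algebra f13" if "2 \<le> i" "i < 13" for i
    using that by (simp add: derived_algebra_f13(2) crd_ev)
  have le: "B (ev i) (ev j) = ?F (ev i) (ev j)" if "i < 13" "j < 13" "i \<le> j" for i j
  proof -
    consider "i = j" | "i = 0" "j = 1" | "i = 0" "2 \<le> j" | "i = 1" "2 \<le> j" | "2 \<le> i" "2 \<le> j"
      using \<open>i \<le> j\<close> by linarith
    then show ?thesis
      by cases (use that B F h in \<open>simp_all add: alternating f13_deformed_alternating\<close>)
  qed
  have "B (ev i) (ev j) = ?F (ev i) (ev j)" if "i < 13" "j < 13" for i j
    using le [of i j] le [of j i] that antisym [of "ev i" "ev j"]
      f13_deformed_antisym [of t "ev i" "ev j"] by (cases "i \<le> j") auto
  then have "B x y = ?F x y" for x y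
    unfolding bilinear_13_expansion [OF left right, of x y]
      bilinear_13_expansion [OF lie_algebra.linear_left lie_algebra.linear_right, OF
        lie_algebra_f13_deformed lie_algebra_f13_deformed, of t x y]
    by simp
  then show "B = ?F"
    by (intro ext)
qed

theorem filiform_f13_deformed: "filiform (f13_deformed t)"
proof -
  let ?B = "f13_deformed t"
  let ?F = "\<lambda>k. {x. \<forall>i<13. i \<le> k \<longrightarrow> crd x i = 0}"
  have "\<forall>a<13. \<forall>b<13. \<forall>i<13. i \<le> max 1 b \<longrightarrow> crd (?B (ev a) (ev b)) i = 0"
    unfolding all_less_13
    by (simp add: f13_deformed_ev crd_ev)
  then have key: "crd (?B (ev a) (ev b)) i = 0" if "a < 13" "b < 13" "i < 13" "i \<le> max 1 b" for a b i
    using that by blast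
  have step: "?B x y \<in> ?F (Suc k)" if "k = 0 \<or> y \<in> ?F k" for x y k
  proof (clarify)
    fix i :: nat assume i: "i < 13" "i \<le> Suc k"
    have "crd x a * crd y b * crd (?B (ev a) (ev b)) i = 0" if "a < 13" "b < 13" for a b
    proof (cases "i \<le> max 1 b")
      case True
      then show ?thesis using key i that by simp
    next
      case False
      then have "b \<le> k" "k \<noteq> 0" using i by auto
      then show ?thesis using \<open>k = 0 \<or> y \<in> ?F k\<close> that by auto
    qed
    then show "crd (?B x y) i = 0"
      unfolding bilinear_13_expansion [OF lie_algebra.linear_left lie_algebra.linear_right, OF
        lie_algebra_f13_deformed lie_algebra_f13_deformed, of t x y]
      by (simp only: crd_sum crd_simps) (intro sum.neutral ballI, simp)
  qed
  have upper: "lower_central ?B (Suc k) \<subseteq> ?F (Suc k)" for k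
  proof (induction k)
    case 0
    have "vec.subspace (?F (Suc 0))"
      by (simp add: vec.subspace_def)
    then show ?case
      using step [of 0] by (simp only: lower_central.simps) (intro vec.span_minimal, auto)
  next
    case (Suc k)
    have "vec.subspace (?F (Suc (Suc k)))"
      by (simp add: vec.subspace_def)
    then show ?case
      using step [of "Suc k"] Suc
      by (subst lower_central.simps) (intro vec.span_minimal, auto)
  qed
  have "\<forall>i<13. 1 \<le> i \<longrightarrow> i < 12 \<longrightarrow> ?B (ev 0) (ev i) = ev (Suc i)"
    unfolding all_less_13 by (simp add: f13_deformed_ev numeral_2_eq_2 [symmetric])
  then have shift: "?B (ev 0) (ev i) = ev (Suc i)" if "1 \<le> i" "i < 12" for i
    using that by auto
  have lower: "k < 12 \<Longrightarrow> ev (Suc k) \<in> lower_central ?B k" for k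
  proof (induction k)
    case (Suc k)
    then have "ev (Suc (Suc k)) = ?B (ev 0) (ev (Suc k))" "ev (Suc k) \<in> lower_central ?B k"
      by (simp_all add: shift)
    then show ?case
      by (subst lower_central.simps) (blast intro: vec.span_base)
  qed simp
  have "lower_central ?B 12 \<subseteq> {0}"
    using upper [of 11] by (auto simp: vec13_eq_iff)
  moreover have "0 \<in> lower_central ?B 12"
    using vec.span_zero by (simp add: eval_nat_numeral)
  ultimately have "lower_central ?B 12 = {0}"
    by blast
  moreover have "crd (ev 12) 12 \<noteq> 0"
    by (simp add: crd_ev)
  then have "ev 12 \<noteq> 0"
    by auto
  then have "lower_central ?B 11 \<noteq> {0}"
    using lower [of 11] by auto
  ultimately show ?thesis
    by (simp add: filiform_def lie_algebra_f13_deformed)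
qed

end

theory Submission
  imports Defs
begin

text \<open>
  Give \<open>ev 0\<close> the weight \<open>1\<close> and \<open>ev i\<close>, for \<open>1 \<le> i \<le> 12\<close>, the weight \<open>i + 1\<close>.  The bracket of
  \<open>f13\<close> is then the sum of a part that preserves the weight and of parts that raise it by \<open>2\<close> and by
  \<open>4\<close>, whereas the deformation term \<open>t *s der_D\<close> raises it by \<open>5\<close>.  What has to be excluded is
  that a change of basis absorbs this term.

  Let \<open>\<phi>\<close> be an isomorphism from \<open>f13_deformed t\<close> onto \<open>f13\<close>.  Since \<open>ev 0\<close> and \<open>ev 1\<close> generate
  the algebra, \<open>\<phi>\<close> is determined by \<open>u = \<phi> (ev 0)\<close> and \<open>v = \<phi> (ev 1)\<close>: the other basis vectors
  are mapped to \<open>w 2 = f13 u v\<close> and \<open>w (Suc i) = f13 u (w i)\<close>.  Two brackets of basis vectors of the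
  deformed algebra restrict \<open>u\<close> and \<open>v\<close> further:
  \<open>[ev 1, ev 2] = ev 4 + t *s ev 9\<close> and
  \<open>[ev 1, ev 4] = (9/10) *s ev 6 - ev 8 + t *s ev 11\<close>.
  Their coordinates are polynomial equations in the coordinates of \<open>u\<close> and \<open>v\<close> that can be solved one
  weight at a time, starting with the lowest one.

  \<^item> Below and in weight shift \<open>0\<close>: \<open>\<phi>\<close> respects the filtration by weight, and its diagonal part
    multiplies each weight \<open>n\<close> by \<open>a ^ n\<close>, where \<open>a = crd u 0 \<noteq> 0\<close>; in particular
    \<open>crd v 1 = a\<^sup>2\<close> (\<open>crd_v_0\<close>, \<open>crd_v_1\<close>).
  \<^item> In weight shift \<open>1\<close>: \<open>crd u 1 = 0\<close> (\<open>crd_u_1\<close>).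
  \<^item> In weight shift \<open>2\<close>: the term \<open>- ev 8\<close> of \<open>[ev 1, ev 4]\<close> is scaled by \<open>a\<^sup>2\<close> relative to the
    weight-preserving part, so that \<open>a\<^sup>2 = 1\<close> (\<open>crd_u_0_square\<close>).
  \<^item> In the weight shifts \<open>2\<close>, \<open>3\<close> and \<open>4\<close>: the first relation determines \<open>crd v 3\<close>, \<open>crd v 4\<close> and
    \<open>crd v 5\<close> (\<open>crd_v_3\<close>, \<open>crd_v_4\<close>, \<open>crd_v_5\<close>).
  \<^item> In weight shift \<open>5\<close>: both relations are affine in the two new unknowns \<open>crd u 5\<close> and
    \<open>crd v 6\<close>, which enter only through one common linear combination.  Eliminating it cancels all
    the lower terms as well and leaves a nonzero multiple of \<open>t\<close>; hence \<open>t = 0\<close>.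
\<close>

section \<open>Coordinates of the bracket\<close>

definition minor :: "complex ^ 13 \<Rightarrow> complex ^ 13 \<Rightarrow> nat \<Rightarrow> nat \<Rightarrow> complex" where
  "minor x y i j = crd x i * crd y j - crd x j * crd y i"

lemma sum_lessThan_13:
  fixes f :: "nat \<Rightarrow> complex"
  shows "(\<Sum>i<13. f i) =
    f 0 + f 1 + f 2 + f 3 + f 4 + f 5 + f 6 + f 7 + f 8 + f 9 + f 10 + f 11 + f 12"
  by (simp add: eval_nat_numeral add.assoc)

text \<open>The structure constants, read coordinatewise: \<open>minor x y i j\<close> occurs in coordinate \<open>k\<close> only if
  the weight of \<open>ev k\<close> exceeds the sum of the weights of \<open>ev i\<close> and \<open>ev j\<close> by \<open>0\<close> or \<open>2\<close>.
  Coordinate \<open>12\<close>, the only one with weight shift \<open>4\<close>, is left out because the relations are compared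
  in coordinates up to \<open>11\<close> only.\<close>

lemma crd_f13:
  "crd (f13 x y) 0 = 0"
  "crd (f13 x y) 1 = 0"
  "crd (f13 x y) 2 = minor x y 0 1"
  "crd (f13 x y) 3 = minor x y 0 2"
  "crd (f13 x y) 4 = minor x y 0 3 + minor x y 1 2"
  "crd (f13 x y) 5 = minor x y 0 4 + minor x y 1 3"
  "crd (f13 x y) 6 = minor x y 0 5 + 9/10 * minor x y 1 4 + 1/10 * minor x y 2 3"
  "crd (f13 x y) 7 = minor x y 0 6 + 4/5 * minor x y 1 5 + 1/10 * minor x y 2 4"
  "crd (f13 x y) 8 = minor x y 0 7 - minor x y 1 4 + 5/7 * minor x y 1 6 + minor x y 2 3
     + 3/35 * minor x y 2 5 + 1/70 * minor x y 3 4"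
  "crd (f13 x y) 9 = minor x y 0 8 - 2 * minor x y 1 5 + 9/14 * minor x y 1 7 + minor x y 2 4
     + 1/14 * minor x y 2 6 + 1/70 * minor x y 3 5"
  "crd (f13 x y) 10 = minor x y 0 9 - 335/126 * minor x y 1 6 + 7/12 * minor x y 1 8
     + 83/126 * minor x y 2 5 + 5/84 * minor x y 2 7 + 43/126 * minor x y 3 4
     + 1/84 * minor x y 3 6 + 1/420 * minor x y 4 5"
  "crd (f13 x y) 11 = minor x y 0 10 - 125/42 * minor x y 1 7 + 8/15 * minor x y 1 9
     + 20/63 * minor x y 2 6 + 1/20 * minor x y 2 8 + 43/126 * minor x y 3 5
     + 1/105 * minor x y 3 7 + 1/420 * minor x y 4 6"
  unfolding f13_def crd_sum crd_simps sum_lessThan_13 minor_def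
  by (simp_all add: f13_basis_values crd_ev algebra_simps)

(* The index 1 has to stay a numeral: the coordinate equations are used as rewrite rules. *)
declare One_nat_def [simp del]

text \<open>Bracketing raises the filtration by the index of the first nonzero coordinate, and only the
  component along \<open>ev 0\<close> raises it by exactly one: \<open>[ev 0, ev j] = ev (Suc j)\<close>, but \<open>[ev i, ev j]\<close>
  with \<open>i \<ge> 1\<close> starts at \<open>ev (i + j + 1)\<close> or later.\<close>

lemma f13_filtration:
  assumes "2 \<le> j" "j \<le> 10" and y: "\<forall>k<j. crd y k = 0"
  shows "\<forall>k<Suc j. crd (f13 x y) k = 0" "crd (f13 x y) (Suc j) = crd x 0 * crd y j"
proof -
  have j: "j \<in> {2, 3, 4, 5, 6, 7, 8, 9, 10}"
    using assms by auto
  have "(\<forall>k\<in>set [0..<Suc j]. crd (f13 x y) k = 0) \<and> crd (f13 x y) (Suc j) = crd x 0 * crd y j"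
    using j y
    by (elim insertE) (simp_all add: upt_conv_Cons crd_f13 minor_def One_nat_def [symmetric])
  then show "\<forall>k<Suc j. crd (f13 x y) k = 0" "crd (f13 x y) (Suc j) = crd x 0 * crd y j"
    unfolding set_upt by auto
qed

section \<open>Frames that satisfy two relations of the deformed algebra\<close>

text \<open>The vectors \<open>u\<close>, \<open>v\<close> and \<open>w i\<close> stand for the images of \<open>ev 0\<close>, \<open>ev 1\<close> and \<open>ev i\<close> under an
  isomorphism.  Besides the brackets with \<open>ev 0\<close>, which determine the \<open>w i\<close>, it is enough that
  it respects \<open>[ev 1, ev 2]\<close> and \<open>[ev 1, ev 4]\<close>.\<close>

locale deformed_frame =
  fixes u v :: "complex ^ 13" and w :: "nat \<Rightarrow> complex ^ 13" and t :: complex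
  assumes w_2: "w 2 = f13 u v"
    and w_Suc: "\<And>i. 2 \<le> i \<Longrightarrow> i < 12 \<Longrightarrow> w (Suc i) = f13 u (w i)"
    and rel_12: "w 4 + t *s w 9 = f13 v (w 2)"
    and rel_14: "(9/10) *s w 6 - w 8 + t *s w 11 = f13 v (w 4)"
    and independent: "minor u v 0 1 \<noteq> 0"
begin

abbreviation x :: "nat \<Rightarrow> complex" where "x \<equiv> crd u"
abbreviation y :: "nat \<Rightarrow> complex" where "y \<equiv> crd v"

lemma w_3: "w 3 = f13 u (w 2)" and w_4: "w 4 = f13 u (w 3)" and w_5: "w 5 = f13 u (w 4)"
  and w_6: "w 6 = f13 u (w 5)" and w_7: "w 7 = f13 u (w 6)" and w_8: "w 8 = f13 u (w 7)"
  using w_Suc [of 2] w_Suc [of 3] w_Suc [of 4] w_Suc [of 5] w_Suc [of 6] w_Suc [of 7] by simp_all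

lemma crd_rel_12: "crd (w 4) k + t * crd (w 9) k = crd (f13 v (w 2)) k"
  by (simp flip: rel_12)

lemma crd_rel_14: "9/10 * crd (w 6) k - crd (w 8) k + t * crd (w 11) k = crd (f13 v (w 4)) k"
  by (simp flip: rel_14)

lemma w_leading:
  assumes "2 \<le> i" "i \<le> 11"
  shows "(\<forall>k<i. crd (w i) k = 0) \<and> crd (w i) i = x 0 ^ (i - 2) * minor u v 0 1"
  using assms
proof (induction i rule: nat_induct_at_least)
  case base
  show ?case
    by (auto simp: w_2 crd_f13 less_2_cases_iff One_nat_def [symmetric])
next
  case (Suc i)
  then have "Suc i - 2 = Suc (i - 2)"
    by simp
  with Suc f13_filtration [of i "w i" u] show ?case
    by (simp add: w_Suc)
qed

lemma crd_w_below: "2 \<le> i \<Longrightarrow> i \<le> 11 \<Longrightarrow> k < i \<Longrightarrow> crd (w i) k = 0"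
  using w_leading by blast

text \<open>A nonzero \<open>ev 0\<close>-component of \<open>v\<close> would let \<open>[v, w 2]\<close> start at \<open>ev 3\<close>, whereas the left-hand
  side of \<open>rel_12\<close> starts at \<open>ev 4\<close>.\<close>

lemma crd_v_0: "y 0 = 0"
proof -
  have "y 0 * minor u v 0 1 = 0"
    using crd_rel_12 [of 3] w_leading [of 2] by (simp add: crd_f13 crd_w_below minor_def [of v])
  then show ?thesis
    using independent by simp
qed

lemma crd_u_0: "x 0 \<noteq> 0"
  using independent by (auto simp: minor_def crd_v_0)

text \<open>The weight-preserving part of \<open>rel_12\<close>.\<close>

lemma crd_v_1: "y 1 = x 0 ^ 2"
proof -
  have "x 0 ^ 2 * minor u v 0 1 = y 1 * minor u v 0 1"
    using crd_rel_12 [of 4] w_leading [of 2] w_leading [of 4]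
    by (simp add: crd_f13 crd_w_below minor_def [of v] crd_v_0)
  then show ?thesis
    using independent by simp
qed

text \<open>The part of weight shift \<open>1\<close> of \<open>rel_12\<close>: the unknown \<open>y 2\<close> cancels, because a shift in the
  direction of \<open>y 2\<close> comes from the inner automorphisms generated by \<open>ev 0\<close>.\<close>

lemma crd_u_1: "x 1 = 0"
proof -
  have "2 * x 0 ^ 4 * x 1 = 0"
    using crd_rel_12 [of 5]
    by (simp add: w_4 w_3 w_2 crd_f13 crd_w_below minor_def crd_v_0 crd_v_1) algebra
  then show ?thesis
    using crd_u_0 by simp
qed

subsection \<open>Expansion of the frame up to weight shift five\<close>

text \<open>Each table unfolds one bracket with \<open>u\<close>.  The coordinate \<open>k\<close> of \<open>w i\<close> has weight shift
  \<open>k - i\<close>, the unknown \<open>x k\<close> has weight shift \<open>k\<close>, and \<open>y k\<close> has weight shift \<open>k - 1\<close>; a monomial in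
  coordinate \<open>k\<close> has total shift \<open>k - i\<close>, or \<open>k - i - 2\<close> if it arises from a structure constant that
  raises the weight.  Only the coordinates that enter the relations in weight shifts up to \<open>5\<close> are
  recorded.\<close>

lemma crd_w_2:
  "crd (w 2) 2 = x 0 ^ 3"
  "crd (w 2) 3 = x 0 * y 2"
  "crd (w 2) 4 = x 0 * y 3 - x 0 ^ 2 * x 2"
  "crd (w 2) 5 = x 0 * y 4 - x 0 ^ 2 * x 3"
  "crd (w 2) 6 = x 0 * y 5 - 9/10 * x 0 ^ 2 * x 4 + 1/10 * x 2 * y 3 - 1/10 * x 3 * y 2"
  "crd (w 2) 7 = x 0 * y 6 - 4/5 * x 0 ^ 2 * x 5 + 1/10 * x 2 * y 4 - 1/10 * x 4 * y 2"
  by (simp_all add: w_2 crd_f13 minor_def crd_w_below crd_v_0 crd_v_1 crd_u_1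
    algebra_simps power_numeral_reduce)

lemma crd_w_3:
  "crd (w 3) 3 = x 0 ^ 4"
  "crd (w 3) 4 = x 0 ^ 2 * y 2"
  "crd (w 3) 5 = x 0 ^ 2 * y 3 - x 0 ^ 3 * x 2"
  "crd (w 3) 6 = x 0 ^ 2 * y 4 - 11/10 * x 0 ^ 3 * x 3 + 1/10 * x 0 * x 2 * y 2"
  "crd (w 3) 7 = x 0 ^ 2 * y 5 - x 0 ^ 3 * x 4 + 1/5 * x 0 * x 2 * y 3 - 1/10 * x 0 * x 3 * y 2
     - 1/10 * x 0 ^ 2 * x 2 ^ 2"
  "crd (w 3) 8 = x 0 ^ 2 * y 6 - x 0 ^ 3 * x 3 - 31/35 * x 0 ^ 3 * x 5 + x 0 * x 2 * y 2
     + 13/70 * x 0 * x 2 * y 4 + 1/70 * x 0 * x 3 * y 3 - 4/35 * x 0 * x 4 * y 2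
     - 1/10 * x 0 ^ 2 * x 2 * x 3"
  by (simp_all add: w_3 crd_f13 minor_def crd_w_below crd_v_0 crd_v_1 crd_u_1 crd_w_2
    algebra_simps power_numeral_reduce)

lemma crd_w_4:
  "crd (w 4) 4 = x 0 ^ 5"
  "crd (w 4) 5 = x 0 ^ 3 * y 2"
  "crd (w 4) 6 = x 0 ^ 3 * y 3 - 9/10 * x 0 ^ 4 * x 2"
  "crd (w 4) 7 = x 0 ^ 3 * y 4 - 11/10 * x 0 ^ 4 * x 3 + 1/5 * x 0 ^ 2 * x 2 * y 2"
  "crd (w 4) 8 = x 0 ^ 3 * y 5 + x 0 ^ 4 * x 2 - 71/70 * x 0 ^ 4 * x 4
     + 2/7 * x 0 ^ 2 * x 2 * y 3 - 3/35 * x 0 ^ 2 * x 3 * y 2 - 13/70 * x 0 ^ 3 * x 2 ^ 2"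
  "crd (w 4) 9 = x 0 ^ 3 * y 6 - x 0 ^ 4 * x 3 - 9/10 * x 0 ^ 4 * x 5 + 2 * x 0 ^ 2 * x 2 * y 2
     + 9/35 * x 0 ^ 2 * x 2 * y 4 + 1/35 * x 0 ^ 2 * x 3 * y 3 - 4/35 * x 0 ^ 2 * x 4 * y 2
     - 27/140 * x 0 ^ 3 * x 2 * x 3 + 1/140 * x 0 * x 2 ^ 2 * y 2"
  by (simp_all add: w_4 crd_f13 minor_def crd_w_below crd_v_0 crd_v_1 crd_u_1 crd_w_3
    algebra_simps power_numeral_reduce)

lemma crd_w_5:
  "crd (w 5) 5 = x 0 ^ 6"
  "crd (w 5) 6 = x 0 ^ 4 * y 2"
  "crd (w 5) 7 = x 0 ^ 4 * y 3 - 4/5 * x 0 ^ 5 * x 2"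
  "crd (w 5) 8 = x 0 ^ 4 * y 4 - 38/35 * x 0 ^ 5 * x 3 + 2/7 * x 0 ^ 3 * x 2 * y 2"
  "crd (w 5) 10 = x 0 ^ 4 * y 6 - 83/126 * x 0 ^ 5 * x 3 - 379/420 * x 0 ^ 5 * x 5
     + 335/126 * x 0 ^ 3 * x 2 * y 2 + 19/60 * x 0 ^ 3 * x 2 * y 4
     + 17/420 * x 0 ^ 3 * x 3 * y 3 - 47/420 * x 0 ^ 3 * x 4 * y 2
     - 113/420 * x 0 ^ 4 * x 2 * x 3 + 2/105 * x 0 ^ 2 * x 2 ^ 2 * y 2"
  by (simp_all add: w_5 crd_f13 minor_def crd_w_below crd_v_0 crd_v_1 crd_u_1 crd_w_4
    algebra_simps power_numeral_reduce)

lemma crd_w_6: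
  "crd (w 6) 6 = x 0 ^ 7"
  "crd (w 6) 7 = x 0 ^ 5 * y 2"
  "crd (w 6) 8 = x 0 ^ 5 * y 3 - 5/7 * x 0 ^ 6 * x 2"
  "crd (w 6) 9 = x 0 ^ 5 * y 4 - 15/14 * x 0 ^ 6 * x 3 + 5/14 * x 0 ^ 4 * x 2 * y 2"
  "crd (w 6) 11 = x 0 ^ 5 * y 6 - 20/63 * x 0 ^ 6 * x 3 - 379/420 * x 0 ^ 6 * x 5
     + 125/42 * x 0 ^ 4 * x 2 * y 2 + 11/30 * x 0 ^ 4 * x 2 * y 4 + 1/20 * x 0 ^ 4 * x 3 * y 3
     - 23/210 * x 0 ^ 4 * x 4 * y 2 - 139/420 * x 0 ^ 5 * x 2 * x 3
     + 1/30 * x 0 ^ 3 * x 2 ^ 2 * y 2"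
  by (simp_all add: w_6 crd_f13 minor_def crd_w_below crd_v_0 crd_v_1 crd_u_1 crd_w_5
    algebra_simps power_numeral_reduce)

lemma crd_w_7:
  "crd (w 7) 7 = x 0 ^ 8"
  "crd (w 7) 8 = x 0 ^ 6 * y 2"
  "crd (w 7) 10 = x 0 ^ 6 * y 4 - 89/84 * x 0 ^ 7 * x 3 + 5/12 * x 0 ^ 5 * x 2 * y 2"
  by (simp_all add: w_7 crd_f13 minor_def crd_w_below crd_v_0 crd_v_1 crd_u_1 crd_w_6
    algebra_simps power_numeral_reduce)

lemma crd_w_8:
  "crd (w 8) 8 = x 0 ^ 9"
  "crd (w 8) 11 = x 0 ^ 7 * y 4 - 21/20 * x 0 ^ 8 * x 3 + 7/15 * x 0 ^ 6 * x 2 * y 2"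
  by (simp_all add: w_8 crd_f13 minor_def crd_w_below crd_v_0 crd_v_1 crd_u_1 crd_w_7
    algebra_simps power_numeral_reduce)

subsection \<open>Solving the relations by increasing weight shift\<close>

lemma crd_v_3: "2 * x 0 ^ 2 * y 3 = y 2 ^ 2"
proof -
  have "x 0 * (2 * x 0 ^ 2 * y 3 - y 2 ^ 2) = 0"
    using crd_rel_12 [of 6]
    by (simp add: crd_w_2 crd_w_4 crd_f13 crd_w_below minor_def crd_v_0 crd_v_1 crd_u_1 field_simps)
      algebra
  then show ?thesis
    using crd_u_0 by simp
qed

text \<open>In \<open>rel_14\<close> the homogeneous terms of weight shift \<open>2\<close> cancel by \<open>crd_v_3\<close>.  What remains are
  the leading terms of \<open>- w 8\<close> and of the bracket \<open>[v, w 4]\<close>, of degrees \<open>9\<close> and \<open>7\<close> in \<open>x 0\<close>.\<close>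

lemma crd_u_0_square: "x 0 ^ 2 = 1"
proof -
  have "x 0 ^ 7 * (x 0 ^ 2 - 1) = 0"
    using crd_rel_14 [of 8] crd_v_3
    by (simp add: crd_w_4 crd_w_6 crd_w_8 crd_f13 crd_w_below minor_def crd_v_0 crd_v_1 crd_u_1
      field_simps) algebra
  then show ?thesis
    using crd_u_0 by simp
qed

lemma crd_v_4: "y 4 = x 0 * x 3 - x 0 * x 2 * y 2 + y 2 ^ 3 / 6"
  using crd_rel_12 [of 7] crd_v_3 crd_u_0_square
  by (simp add: crd_w_2 crd_w_4 crd_f13 crd_w_below minor_def crd_v_0 crd_v_1 crd_u_1 field_simps)
    algebra

lemma crd_v_5: "y 5 = x 0 * x 4 + x 2 ^ 2 / 2 - x 0 * x 2 * y 2 ^ 2 / 2 + y 2 ^ 4 / 24"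
  using crd_rel_12 [of 8] crd_v_3 crd_v_4 crd_u_0_square
  by (simp add: crd_w_2 crd_w_4 crd_f13 crd_w_below minor_def crd_v_0 crd_v_1 crd_u_1 field_simps)
    algebra

text \<open>Coordinate \<open>9\<close> of \<open>rel_12\<close> and coordinate \<open>11\<close> of \<open>rel_14\<close> are the parts of weight shift
  \<open>5\<close>.  Both contain \<open>x 5\<close> and \<open>y 6\<close> only through \<open>9 * x 5 - 10 * x 0 * y 6\<close>; its elimination
  cancels everything except a nonzero multiple of \<open>t\<close>.\<close>

lemma deformation_parameter_eq_0: "t = 0"
proof -
  have minor: "minor u v 0 1 = x 0 ^ 3"
    by (simp add: minor_def crd_v_0 crd_v_1 power_numeral_reduce)
  have even: "x 0 ^ 10 = 1" "x 0 ^ 12 = 1"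
    using crd_u_0_square power_mult [of "x 0" 2 5] power_mult [of "x 0" 2 6] by simp_all
  have "crd (w 9) 9 = 1" "crd (w 11) 11 = 1"
    using w_leading [of 9] w_leading [of 11] even
    by (simp_all add: minor flip: power_add)
  then show ?thesis
    using crd_rel_12 [of 9] crd_rel_14 [of 11] crd_v_3 crd_v_4 crd_v_5 crd_u_0_square
    by (simp add: crd_w_2 crd_w_4 crd_w_6 crd_w_8 crd_f13 crd_w_below minor_def
      crd_v_0 crd_v_1 crd_u_1 field_simps) algebra
qed

end

section \<open>Isomorphisms yield frames\<close>

lemma f13_deformed_ev_0:
  assumes "1 \<le> i" "i < 12"
  shows "f13_deformed t (ev 0) (ev i) = ev (Suc i)"
proof -
  have "\<forall>i<13. 1 \<le> i \<longrightarrow> i < 12 \<longrightarrow> f13_deformed t (ev 0) (ev i) = ev (Suc i)"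
    unfolding all_less_13 by (simp add: f13_deformed_ev One_nat_def numeral_2_eq_2 [symmetric])
  then show ?thesis
    using assms by simp
qed

text \<open>The images of \<open>ev 2\<close>, \<dots>, \<open>ev 12\<close> are brackets, hence have no components along \<open>ev 0\<close> and
  \<open>ev 1\<close>.  A surjective map must therefore reach these two directions from \<open>ev 0\<close> and \<open>ev 1\<close>.\<close>

lemma minor_neq_0_if_surj:
  assumes lin: "Vector_Spaces.linear (*s) (*s) \<phi>" and surj: "surj \<phi>"
    and derived: "\<And>i k. 2 \<le> i \<Longrightarrow> i < 13 \<Longrightarrow> k < 2 \<Longrightarrow> crd (\<phi> (ev i)) k = 0"
  shows "minor (\<phi> (ev 0)) (\<phi> (ev 1)) 0 1 \<noteq> 0"
proof -
  interpret Vector_Spaces.linear "(*s)" "(*s)" \<phi>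
    by (rule lin)
  have crd: "crd (\<phi> z) k = crd z 0 * crd (\<phi> (ev 0)) k + crd z 1 * crd (\<phi> (ev 1)) k"
    if "k < 2" for z k
  proof -
    have "crd (\<phi> z) k = crd (\<phi> (\<Sum>i<13. crd z i *s ev i)) k"
      by (simp flip: ev_expansion)
    also have "\<dots> = (\<Sum>i<13. crd z i * crd (\<phi> (ev i)) k)"
      by (simp add: sum scale crd_sum)
    finally show ?thesis
      using that by (simp add: sum_lessThan_13 derived)
  qed
  obtain p q where "\<phi> p = ev 0" "\<phi> q = ev 1"
    using surj by (metis surjD)
  then have "1 = crd p 0 * crd (\<phi> (ev 0)) 0 + crd p 1 * crd (\<phi> (ev 1)) 0"
    "0 = crd p 0 * crd (\<phi> (ev 0)) 1 + crd p 1 * crd (\<phi> (ev 1)) 1"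
    "0 = crd q 0 * crd (\<phi> (ev 0)) 0 + crd q 1 * crd (\<phi> (ev 1)) 0"
    "1 = crd q 0 * crd (\<phi> (ev 0)) 1 + crd q 1 * crd (\<phi> (ev 1)) 1"
    using crd [of 0 p] crd [of 1 p] crd [of 0 q] crd [of 1 q] by (simp_all add: crd_ev)
  then have "minor p q 0 1 * minor (\<phi> (ev 0)) (\<phi> (ev 1)) 0 1 = 1"
    unfolding minor_def by algebra
  then show ?thesis
    by auto
qed

lemma deformed_frame_if_isomorphism:
  assumes lin: "Vector_Spaces.linear (*s) (*s) \<phi>" and surj: "surj \<phi>"
    and hom: "\<And>x y. \<phi> (f13_deformed t x y) = f13 (\<phi> x) (\<phi> y)"
  shows "deformed_frame (\<phi> (ev 0)) (\<phi> (ev 1)) (\<lambda>i. \<phi> (ev i)) t"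
proof -
  interpret Vector_Spaces.linear "(*s)" "(*s)" \<phi>
    by (rule lin)
  have shift: "\<phi> (ev (Suc i)) = f13 (\<phi> (ev 0)) (\<phi> (ev i))" if "1 \<le> i" "i < 12" for i
    using hom [of "ev 0" "ev i"] that by (simp add: f13_deformed_ev_0)
  have "crd (\<phi> (ev i)) k = 0" if "2 \<le> i" "i < 13" "k < 2" for i k
  proof -
    have "\<phi> (ev i) = f13 (\<phi> (ev 0)) (\<phi> (ev (i - 1)))" and "k = 0 \<or> k = 1"
      using shift [of "i - 1"] that by auto
    then show ?thesis
      by (auto simp: crd_f13)
  qed
  then have minor: "minor (\<phi> (ev 0)) (\<phi> (ev 1)) 0 1 \<noteq> 0"
    using lin surj by (intro minor_neq_0_if_surj)
  have "f13_deformed t (ev 1) (ev 2) = ev 4 + t *s ev 9"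
    "f13_deformed t (ev 1) (ev 4) = (9/10) *s ev 6 - ev 8 + t *s ev 11"
    by (simp_all add: f13_deformed_ev One_nat_def)
  then show ?thesis
    using hom [of "ev 1" "ev 2"] hom [of "ev 1" "ev 4"] shift [of 1] minor
    by unfold_locales (simp_all add: shift add diff scale Suc_1)
qed

theorem theorem3p3:
  fixes t :: complex
  shows "lie_isomorphic (f13_deformed t) f13 \<longleftrightarrow> t = 0"
proof
  assume "lie_isomorphic (f13_deformed t) f13"
  then obtain \<phi> where "Vector_Spaces.linear (*s) (*s) \<phi>" "surj \<phi>"
    "\<And>x y. \<phi> (f13_deformed t x y) = f13 (\<phi> x) (\<phi> y)"
    unfolding lie_isomorphic_def by (auto dest: bij_is_surj)
  then show "t = 0"
    by (rule deformed_frame.deformation_parameter_eq_0 [OF deformed_frame_if_isomorphism])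
next
  assume "t = 0"
  then have "f13_deformed t = f13"
    by (simp add: f13_deformed_0)
  moreover have "Vector_Spaces.linear (*s) (*s) (\<lambda>x :: complex ^ 13. x)"
    by (simp add: linear_vec_iff)
  ultimately show "lie_isomorphic (f13_deformed t) f13"
    unfolding lie_isomorphic_def by (intro exI [of _ "\<lambda>x. x"]) (simp add: bij_betw_def)
qed

end
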